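(* Let $R,d,a,\lambda$ be positive numbers and $\delta>1$. With $\lambda_k$, $\beta_{k,l}$ and $e_{k,l}$ as in the context, call $e_{k,l}$ stable (unstable) if the corresponding eigenvalue $\beta_{k,l}$ has negative (positive) real part. Then: 1. If $\lambda-a>(\lambda+a)^3$, then the constant eigenvectors $e_{0,l}$, $l=1,2$, are unstable. 2. If $\lambda-a<(\lambda+a)^3$ and $d(\lambda-a)>(a+\lambda)^3+2\sqrt d(a+\lambda)^2$, and no $\lambda_k$ equals one of the two numbers $$\frac{R^2}{2d}\left[d\frac{\lambda-a}{\lambda+a}-(\lambda+a)^2\pm\sqrt{\left[d\frac{\lambda-a}{\lambda+a}-(\lambda+a)^2\right]^2-4d(\lambda+a)^2}\right],$$ then $e_{k,2}$ is unstable for every $k$ such that $\lambda_k$ lies between these two numbers, and all the other eigenvectors (including $e_{0,l}$) are stable. If no $\lambda_k$ lies in this interval then every eigenvector is stable. 3. If $\lambda-a<(\lambda+a)^3$ and $d(\lambda-a)<(a+\lambda)^3+2\sqrt d(a+\lambda)^2$, then all the eigenvectors are stable.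
   Context: $\Omega=\{(r,\theta):1\le r\le\delta,\ 0\le\theta<2\pi\}$ is an annulus. Let $0=\lambda_0<\lambda_1\le\lambda_2\le\cdots$ be the eigenvalues (with multiplicity) of $-\Delta$ on $\Omega$ with Neumann boundary conditions, $\Delta B_k=-\lambda_kB_k$, with $B_0$ constant. Consider the eigenvalue problem $$\Delta u+R^2\Bigl[\tfrac{\lambda-a}{a+\lambda}u+(a+\lambda)^2v\Bigr]=\beta u,\qquad d\Delta v-R^2\Bigl[\tfrac{2\lambda}{a+\lambda}u+(a+\lambda)^2v\Bigr]=\beta v\quad\text{in }\Omega,\qquad u_r=v_r=0\text{ at }r=1,\delta .$$ Its eigenvectors have the form $e_{k,l}=(u_{k,l}B_k,\,v_{k,l}B_k)$, $l\in\{1,2\}$, with eigenvalues $\beta_{k,1},\beta_{k,2}$ the two roots $\beta$ of $$\Bigl(\beta-R^2\tfrac{\lambda-a}{\lambda+a}+\lambda_k\Bigr)\bigl(\beta+R^2(a+\lambda)^2+d\lambda_k\bigr)=-2R^4\lambda(a+\lambda),$$ where $\beta_{k,2}$ is the root given by the plus sign in the quadratic formula (the larger root when the roots are real). *)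

theory Defs
  imports "HOL-Analysis.Analysis"
begin

definition annulus :: "real \<Rightarrow> (real^2) set" where
  "annulus \<delta> = {x. 1 \<le> norm x \<and> norm x \<le> \<delta>}"

text \<open>
  All derivatives are taken within the closed annulus.  For \<open>\<delta> > 1\<close> they are uniquely
  determined, also at boundary points, and depend only on the values on the annulus.
\<close>

definition pderiv_ann :: "real \<Rightarrow> real^2 \<Rightarrow> (real^2 \<Rightarrow> 'b::real_normed_vector) \<Rightarrow> real^2 \<Rightarrow> 'b" where
  "pderiv_ann \<delta> h f x = frechet_derivative f (at x within annulus \<delta>) h"

definition C2_ann :: "real \<Rightarrow> (real^2 \<Rightarrow> 'b::real_normed_vector) \<Rightarrow> bool" where
  "C2_ann \<delta> f \<longleftrightarrow>
     f differentiable_on annulus \<delta> \<and>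
     (\<forall>i\<in>Basis. pderiv_ann \<delta> i f differentiable_on annulus \<delta> \<and>
        (\<forall>j\<in>Basis. continuous_on (annulus \<delta>) (pderiv_ann \<delta> j (pderiv_ann \<delta> i f))))"

definition laplacian :: "real \<Rightarrow> (real^2 \<Rightarrow> 'b::real_normed_vector) \<Rightarrow> real^2 \<Rightarrow> 'b" where
  "laplacian \<delta> f x = (\<Sum>i\<in>Basis. pderiv_ann \<delta> i (pderiv_ann \<delta> i f) x)"

definition neumann_bc :: "real \<Rightarrow> (real^2 \<Rightarrow> 'b::real_normed_vector) \<Rightarrow> bool" where
  "neumann_bc \<delta> f \<longleftrightarrow>
     (\<forall>x. norm x = 1 \<or> norm x = \<delta> \<longrightarrow> pderiv_ann \<delta> (x /\<^sub>R norm x) f x = 0)"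

definition neumann_eigenspace :: "real \<Rightarrow> real \<Rightarrow> (real^2 \<Rightarrow> real) set" where
  "neumann_eigenspace \<delta> \<nu> =
     {f. C2_ann \<delta> f \<and> neumann_bc \<delta> f \<and> (\<forall>x\<in>annulus \<delta>. laplacian \<delta> f x = - \<nu> * f x)}"

text \<open>
  \<open>\<mu> 0, \<mu> 1, \<dots>\<close> lists all Neumann eigenvalues of the negative Laplacian in increasing order,
  repeated according to multiplicity: for every real \<open>\<nu>\<close> the functions \<open>B k\<close> with
  \<open>\<mu> k = \<nu>\<close> form a basis of the eigenspace of \<open>\<nu>\<close> (which is the zero space, with empty
  basis, if \<open>\<nu>\<close> is not an eigenvalue).  Functions are compared on the annulus only.
\<close>

definition neumann_spectrum :: "real \<Rightarrow> (nat \<Rightarrow> real) \<Rightarrow> (nat \<Rightarrow> real^2 \<Rightarrow> real) \<Rightarrow> bool" where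
  "neumann_spectrum \<delta> \<mu> B \<longleftrightarrow>
     \<mu> 0 = 0 \<and> 0 < \<mu> 1 \<and> (\<forall>k\<ge>1. \<mu> k \<le> \<mu> (Suc k)) \<and>
     (\<exists>c. \<forall>x\<in>annulus \<delta>. B 0 x = c) \<and>
     (\<forall>k. B k \<in> neumann_eigenspace \<delta> (\<mu> k)) \<and>
     (\<forall>\<nu> S c. finite S \<and> S \<subseteq> {k. \<mu> k = \<nu>} \<and> (\<forall>x\<in>annulus \<delta>. (\<Sum>k\<in>S. c k * B k x) = 0)
        \<longrightarrow> (\<forall>k\<in>S. c k = 0)) \<and>
     (\<forall>\<nu>. \<forall>f\<in>neumann_eigenspace \<delta> \<nu>. \<exists>S c. finite S \<and> S \<subseteq> {k. \<mu> k = \<nu>} \<and>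
        (\<forall>x\<in>annulus \<delta>. f x = (\<Sum>k\<in>S. c k * B k x)))"

text \<open>Eigenvectors are complex-valued, since the eigenvalues \<open>\<beta>\<close> may be non-real.\<close>

definition system_eigenvector ::
  "real \<Rightarrow> real \<Rightarrow> real \<Rightarrow> real \<Rightarrow> real \<Rightarrow> complex \<Rightarrow> (real^2 \<Rightarrow> complex) \<times> (real^2 \<Rightarrow> complex) \<Rightarrow> bool"
where
  "system_eigenvector R d a lambda \<delta> \<beta> = (\<lambda>(u, v).
     C2_ann \<delta> u \<and> C2_ann \<delta> v \<and> neumann_bc \<delta> u \<and> neumann_bc \<delta> v \<and>
     (\<forall>x\<in>annulus \<delta>.
        laplacian \<delta> u x
          + of_real (R\<^sup>2) * (of_real ((lambda - a) / (a + lambda)) * u x + of_real ((a + lambda)\<^sup>2) * v x)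
          = \<beta> * u x \<and>
        of_real d * laplacian \<delta> v x
          - of_real (R\<^sup>2) * (of_real (2 * lambda / (a + lambda)) * u x + of_real ((a + lambda)\<^sup>2) * v x)
          = \<beta> * v x) \<and>
     (\<exists>x\<in>annulus \<delta>. u x \<noteq> 0 \<or> v x \<noteq> 0))"

definition stable ::
  "real \<Rightarrow> real \<Rightarrow> real \<Rightarrow> real \<Rightarrow> real \<Rightarrow> (real^2 \<Rightarrow> complex) \<times> (real^2 \<Rightarrow> complex) \<Rightarrow> bool"
where
  "stable R d a lambda \<delta> e \<longleftrightarrow> (\<exists>\<beta>. system_eigenvector R d a lambda \<delta> \<beta> e \<and> Re \<beta> < 0)"

definition unstable ::
  "real \<Rightarrow> real \<Rightarrow> real \<Rightarrow> real \<Rightarrow> real \<Rightarrow> (real^2 \<Rightarrow> complex) \<times> (real^2 \<Rightarrow> complex) \<Rightarrow> bool"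
where
  "unstable R d a lambda \<delta> e \<longleftrightarrow> (\<exists>\<beta>. system_eigenvector R d a lambda \<delta> \<beta> e \<and> Re \<beta> > 0)"

text \<open>The existential quantifiers are harmless: an eigenvector has only one eigenvalue.\<close>

lemma system_eigenvector_unique:
  assumes "system_eigenvector R d a lambda \<delta> \<beta> e" "system_eigenvector R d a lambda \<delta> \<gamma> e"
  shows "\<beta> = \<gamma>"
proof -
  obtain u v where e: "e = (u, v)" by fastforce
  obtain x where x: "x \<in> annulus \<delta>" and nz: "u x \<noteq> 0 \<or> v x \<noteq> 0"
    using assms(1) unfolding system_eigenvector_def e by auto
  have "\<beta> * u x = \<gamma> * u x" "\<beta> * v x = \<gamma> * v x"
    using assms x unfolding system_eigenvector_def e prod.case by metis+
  with nz show ?thesis by auto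
qed

lemma stable_iff:
  "system_eigenvector R d a lambda \<delta> \<beta> e \<Longrightarrow> stable R d a lambda \<delta> e \<longleftrightarrow> Re \<beta> < 0"
  "system_eigenvector R d a lambda \<delta> \<beta> e \<Longrightarrow> unstable R d a lambda \<delta> e \<longleftrightarrow> Re \<beta> > 0"
  unfolding stable_def unstable_def using system_eigenvector_unique by blast+

text \<open>
  Sum and product of the roots \<open>\<beta>\<close> of
  \<open>(\<beta> - R\<^sup>2 (lambda - a) / (lambda + a) + \<nu>) (\<beta> + R\<^sup>2 (a + lambda)\<^sup>2 + d \<nu>) = - 2 R\<^sup>4 lambda (a + lambda)\<close>,
  and the roots themselves by the quadratic formula, with the plus sign for \<open>l = 2\<close>
  and the minus sign for \<open>l = 1\<close>.
\<close>

definition root_sum :: "real \<Rightarrow> real \<Rightarrow> real \<Rightarrow> real \<Rightarrow> real \<Rightarrow> real" where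
  "root_sum R d a lambda \<nu> = (R\<^sup>2 * ((lambda - a) / (lambda + a)) - \<nu>) - (R\<^sup>2 * (a + lambda)\<^sup>2 + d * \<nu>)"

definition root_prod :: "real \<Rightarrow> real \<Rightarrow> real \<Rightarrow> real \<Rightarrow> real \<Rightarrow> real" where
  "root_prod R d a lambda \<nu> =
     2 * R^4 * lambda * (a + lambda) - (R\<^sup>2 * ((lambda - a) / (lambda + a)) - \<nu>) * (R\<^sup>2 * (a + lambda)\<^sup>2 + d * \<nu>)"

definition beta :: "real \<Rightarrow> real \<Rightarrow> real \<Rightarrow> real \<Rightarrow> real \<Rightarrow> nat \<Rightarrow> complex" where
  "beta R d a lambda \<nu> l =
     (of_real (root_sum R d a lambda \<nu>)
        + (if l = 2 then 1 else - 1)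
          * csqrt (of_real ((root_sum R d a lambda \<nu>)\<^sup>2 - 4 * root_prod R d a lambda \<nu>))) / 2"

lemma beta_roots:
  "(z - of_real (R\<^sup>2 * ((lambda - a) / (lambda + a))) + of_real \<nu>)
     * (z + of_real (R\<^sup>2 * (a + lambda)\<^sup>2) + of_real (d * \<nu>))
     + of_real (2 * R^4 * lambda * (a + lambda))
   = (z - beta R d a lambda \<nu> 1) * (z - beta R d a lambda \<nu> 2)"
proof -
  define s p where "s = root_sum R d a lambda \<nu>" and "p = root_prod R d a lambda \<nu>"
  define w where "w = csqrt (of_real (s\<^sup>2 - 4 * p))"
  have w: "w * w = of_real s * of_real s - 4 * of_real p"
    using power2_csqrt[of "of_real (s\<^sup>2 - 4 * p)"] unfolding w_def
    by (simp add: power2_eq_square)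
  have "(z - beta R d a lambda \<nu> 1) * (z - beta R d a lambda \<nu> 2)
        = z * z - of_real s * z + (of_real s * of_real s - w * w) / 4"
    unfolding beta_def s_def[symmetric] p_def[symmetric] w_def[symmetric]
    by (simp add: field_simps)
  also have "\<dots> = z * z - of_real s * z + of_real p"
    unfolding w by simp
  finally have eq: "(z - beta R d a lambda \<nu> 1) * (z - beta R d a lambda \<nu> 2)
    = z * z - of_real s * z + of_real p" .
  define X Y Q where "X = R\<^sup>2 * ((lambda - a) / (lambda + a))"
    and "Y = R\<^sup>2 * (a + lambda)\<^sup>2" and "Q = 2 * R^4 * lambda * (a + lambda)"
  have s: "s = (X - \<nu>) - (Y + d * \<nu>)" and p: "p = Q - (X - \<nu>) * (Y + d * \<nu>)"
    unfolding s_def p_def root_sum_def root_prod_def X_def Y_def Q_def by simp_all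
  show ?thesis
    unfolding eq unfolding X_def[symmetric] Y_def[symmetric] Q_def[symmetric]
    unfolding s p of_real_add of_real_diff of_real_mult
    by (simp add: algebra_simps)
qed

definition mu_minus :: "real \<Rightarrow> real \<Rightarrow> real \<Rightarrow> real \<Rightarrow> real" where
  "mu_minus R d a lambda = R\<^sup>2 / (2 * d) *
     ((d * ((lambda - a) / (lambda + a)) - (lambda + a)\<^sup>2)
        - sqrt ((d * ((lambda - a) / (lambda + a)) - (lambda + a)\<^sup>2)\<^sup>2 - 4 * d * (lambda + a)\<^sup>2))"

definition mu_plus :: "real \<Rightarrow> real \<Rightarrow> real \<Rightarrow> real \<Rightarrow> real" where
  "mu_plus R d a lambda = R\<^sup>2 / (2 * d) *
     ((d * ((lambda - a) / (lambda + a)) - (lambda + a)\<^sup>2)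
        + sqrt ((d * ((lambda - a) / (lambda + a)) - (lambda + a)\<^sup>2)\<^sup>2 - 4 * d * (lambda + a)\<^sup>2))"

end

theory Submission
  imports Defs
begin

text \<open>
  The real parts of the roots are controlled by their sum and product. At
  \<open>\<nu> = 0\<close> the product is \<open>R\<^sup>4 (a + lambda)\<^sup>2 > 0\<close>, and as a function of \<open>\<nu>\<close> it is a quadratic
  polynomial with zeros \<open>mu_minus\<close> and \<open>mu_plus\<close>, while the sum is negative for all \<open>\<nu> \<ge> 0\<close> as
  soon as it is negative at \<open>\<nu> = 0\<close>. Hence stability is lost exactly where the product is
  negative.
\<close>

section \<open>Signs of the real parts of a pair of roots from its sum and product\<close>

lemma Re_csqrt_of_real: "Re (csqrt (of_real x)) = sqrt (max x 0)"
  by (cases "x \<ge> 0") (auto simp: csqrt_of_real_nonneg csqrt_of_real_nonpos)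

text \<open>A negative discriminant has a purely imaginary square root, which drops out of the real
  part; the \<open>max\<close> thus treats real and complex conjugate pairs in one formula.\<close>

lemma Re_beta:
  "Re (beta R d a lambda \<nu> l) =
     (root_sum R d a lambda \<nu> + (if l = 2 then 1 else - 1) *
        sqrt (max ((root_sum R d a lambda \<nu>)\<^sup>2 - 4 * root_prod R d a lambda \<nu>) 0)) / 2"
proof -
  let ?x = "(root_sum R d a lambda \<nu>)\<^sup>2 - 4 * root_prod R d a lambda \<nu>"
  have "Re (beta R d a lambda \<nu> l) =
      (root_sum R d a lambda \<nu> + (if l = 2 then 1 else - 1) * Re (csqrt (of_real ?x))) / 2"
    unfolding beta_def by (cases "l = 2") simp_all
  then show ?thesis
    unfolding Re_csqrt_of_real .
qed

text \<open>A positive product puts the discriminant below \<open>s\<^sup>2\<close>, so the square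
  root cannot overturn the sign of the sum. That \<open>s\<close> is nonzero matters when the
  \<open>max\<close> is 0.\<close>

lemma sqrt_max_less_abs:
  fixes s p :: real
  assumes "s \<noteq> 0" "p > 0"
  shows "sqrt (max (s\<^sup>2 - 4 * p) 0) < \<bar>s\<bar>"
proof -
  have "max (s\<^sup>2 - 4 * p) 0 < s\<^sup>2"
    using assms by simp
  then have "sqrt (max (s\<^sup>2 - 4 * p) 0) < sqrt (s\<^sup>2)"
    by (rule real_sqrt_less_mono)
  then show ?thesis by simp
qed

lemma abs_less_sqrt_max:
  fixes s p :: real
  assumes "p < 0"
  shows "\<bar>s\<bar> < sqrt (max (s\<^sup>2 - 4 * p) 0)"
proof -
  have "s\<^sup>2 < max (s\<^sup>2 - 4 * p) 0"
    using assms by simp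
  then have "sqrt (s\<^sup>2) < sqrt (max (s\<^sup>2 - 4 * p) 0)"
    by (rule real_sqrt_less_mono)
  then show ?thesis by simp
qed

lemma Re_beta_neg:
  assumes "root_sum R d a lambda \<nu> < 0" "root_prod R d a lambda \<nu> > 0"
  shows "Re (beta R d a lambda \<nu> l) < 0"
proof -
  define w where
    "w = sqrt (max ((root_sum R d a lambda \<nu>)\<^sup>2 - 4 * root_prod R d a lambda \<nu>) 0)"
  have "0 \<le> w" "w < \<bar>root_sum R d a lambda \<nu>\<bar>"
    using sqrt_max_less_abs[of "root_sum R d a lambda \<nu>"] assms unfolding w_def by simp_all
  then show ?thesis
    using assms(1) unfolding Re_beta w_def[symmetric] by auto
qed

lemma Re_beta_pos:
  assumes "root_sum R d a lambda \<nu> > 0" "root_prod R d a lambda \<nu> > 0"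
  shows "Re (beta R d a lambda \<nu> l) > 0"
proof -
  define w where
    "w = sqrt (max ((root_sum R d a lambda \<nu>)\<^sup>2 - 4 * root_prod R d a lambda \<nu>) 0)"
  have "0 \<le> w" "w < \<bar>root_sum R d a lambda \<nu>\<bar>"
    using sqrt_max_less_abs[of "root_sum R d a lambda \<nu>"] assms unfolding w_def by simp_all
  then show ?thesis
    using assms(1) unfolding Re_beta w_def[symmetric] by auto
qed

text \<open>The square root now exceeds the absolute value of the sum, so the sign in front of it
  decides the sign of the root. This is what singles out \<open>l = 2\<close>.\<close>

lemma Re_beta_saddle:
  assumes "root_prod R d a lambda \<nu> < 0"
  shows "Re (beta R d a lambda \<nu> 2) > 0"
    and "l \<noteq> 2 \<Longrightarrow> Re (beta R d a lambda \<nu> l) < 0"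
  using abs_less_sqrt_max[OF assms, of "root_sum R d a lambda \<nu>"]
  by (auto simp: Re_beta)

section \<open>Sum and product as functions of the Laplacian eigenvalue\<close>

lemma root_sum_0:
  assumes "lambda + a > 0"
  shows "root_sum R d a lambda 0 = R\<^sup>2 * (lambda - a - (lambda + a)^3) / (lambda + a)"
  using assms by (simp add: root_sum_def field_simps power2_eq_square power3_eq_cube)

text \<open>The sum is affine in \<open>\<nu>\<close> with slope \<open>- (1 + d)\<close>, so its
  largest value on \<open>\<nu> \<ge> 0\<close> is the one at 0.\<close>

lemma root_sum_neg:
  assumes "R > 0" "d > 0" "lambda + a > 0" "lambda - a < (lambda + a)^3" "\<nu> \<ge> 0"
  shows "root_sum R d a lambda \<nu> < 0"
proof -
  have "root_sum R d a lambda \<nu> = root_sum R d a lambda 0 - (1 + d) * \<nu>"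
    by (simp add: root_sum_def algebra_simps)
  moreover have "root_sum R d a lambda 0 < 0"
    using assms by (simp add: root_sum_0 divide_less_0_iff mult_less_0_iff)
  ultimately show ?thesis
    using assms by (smt (verit) mult_nonneg_nonneg)
qed

lemma root_prod_eq:
  assumes "lambda + a > 0"
  shows "root_prod R d a lambda \<nu> =
    d * \<nu>\<^sup>2 - R\<^sup>2 * (d * ((lambda - a) / (lambda + a)) - (lambda + a)\<^sup>2) * \<nu>
      + R^4 * (lambda + a)\<^sup>2"
proof -
  define t q where "t = lambda + a" and "q = (lambda - a) / t"
  have "lambda - a = q * t"
    using assms by (simp add: q_def t_def)
  \<comment> \<open>This identity makes the \<open>q\<close>-terms in the constant coefficient
    cancel, leaving \<open>R^4 * t\<^sup>2\<close>.\<close>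
  then have "2 * lambda = t + q * t"
    by (simp add: t_def)
  moreover have "2 * R^4 * lambda * t = R^4 * (2 * lambda) * t"
    by simp
  ultimately have *: "2 * R^4 * lambda * t = R^4 * (t + q * t) * t"
    by (simp only:)
  show ?thesis
    unfolding root_prod_def add.commute[of a lambda] t_def[symmetric] q_def[symmetric] *
    by (simp add: algebra_simps power2_eq_square power4_eq_xxxx)
qed

lemma root_prod_0_pos:
  assumes "R > 0" "lambda + a > 0"
  shows "root_prod R d a lambda 0 > 0"
  using assms by (simp add: root_prod_eq)

lemma root_prod_factor:
  assumes "d > 0" "lambda + a > 0"
    and "(d * ((lambda - a) / (lambda + a)) - (lambda + a)\<^sup>2)\<^sup>2 \<ge> 4 * d * (lambda + a)\<^sup>2"
  shows "root_prod R d a lambda \<nu> =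
    d * (\<nu> - mu_minus R d a lambda) * (\<nu> - mu_plus R d a lambda)"
proof -
  define t where "t = lambda + a"
  define b where "b = d * ((lambda - a) / t) - t\<^sup>2"
  define w where "w = sqrt (b\<^sup>2 - 4 * d * t\<^sup>2)"
  \<comment> \<open>The discriminant hypothesis enters here: squaring undoes \<open>sqrt\<close>
    only for a nonnegative radicand.\<close>
  have w: "w\<^sup>2 = b\<^sup>2 - 4 * d * t\<^sup>2"
    using assms(3) unfolding w_def t_def[symmetric] b_def[symmetric]
    by (intro real_sqrt_pow2) linarith
  have "d * (\<nu> - R\<^sup>2 / (2 * d) * (b - w)) * (\<nu> - R\<^sup>2 / (2 * d) * (b + w)) =
      d * \<nu>\<^sup>2 - R\<^sup>2 * b * \<nu> + R^4 * (b\<^sup>2 - w\<^sup>2) / (4 * d)"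
    using assms(1) by (simp add: field_simps power2_eq_square power4_eq_xxxx)
  also have "\<dots> = d * \<nu>\<^sup>2 - R\<^sup>2 * b * \<nu> + R^4 * t\<^sup>2"
    using assms(1) by (simp add: w)
  finally show ?thesis
    unfolding root_prod_eq[OF assms(2)] mu_minus_def mu_plus_def
      t_def[symmetric] b_def[symmetric] w_def[symmetric] by simp
qed

lemma mu_minus_le_mu_plus:
  assumes "d > 0"
    and "(d * ((lambda - a) / (lambda + a)) - (lambda + a)\<^sup>2)\<^sup>2 \<ge> 4 * d * (lambda + a)\<^sup>2"
  shows "mu_minus R d a lambda \<le> mu_plus R d a lambda"
  unfolding mu_minus_def mu_plus_def
  by (intro mult_left_mono) (use assms in auto)

text \<open>The radicand is strictly below the square of the positive leading term. This keeps the
  constant mode outside the instability interval.\<close>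

lemma mu_minus_pos:
  assumes "R > 0" "d > 0" "lambda + a > 0"
    and "d * ((lambda - a) / (lambda + a)) - (lambda + a)\<^sup>2 > 0"
  shows "mu_minus R d a lambda > 0"
proof -
  define b where "b = d * ((lambda - a) / (lambda + a)) - (lambda + a)\<^sup>2"
  have "sqrt (b\<^sup>2 - 4 * d * (lambda + a)\<^sup>2) < sqrt (b\<^sup>2)"
    using assms by (intro real_sqrt_less_mono) simp
  then have "sqrt (b\<^sup>2 - 4 * d * (lambda + a)\<^sup>2) < b"
    using assms(4) by (simp add: b_def)
  then show ?thesis
    using assms unfolding mu_minus_def b_def[symmetric] by simp
qed

text \<open>Division by \<open>lambda + a\<close> compares the linear coefficient of the product
  with the threshold at which its discriminant in \<open>\<nu>\<close> vanishes.\<close>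

lemma turing_condition_iff:
  fixes d a lambda :: real
  assumes "lambda + a > 0"
  shows "d * (lambda - a) > (a + lambda)^3 + 2 * sqrt d * (a + lambda)\<^sup>2 \<longleftrightarrow>
      d * ((lambda - a) / (lambda + a)) - (lambda + a)\<^sup>2 > 2 * sqrt d * (lambda + a)"
    and "d * (lambda - a) < (a + lambda)^3 + 2 * sqrt d * (a + lambda)\<^sup>2 \<longleftrightarrow>
      d * ((lambda - a) / (lambda + a)) - (lambda + a)\<^sup>2 < 2 * sqrt d * (lambda + a)"
proof -
  define t b where "t = lambda + a" and "b = d * ((lambda - a) / t) - t\<^sup>2"
  have t: "t > 0" "a + lambda = t"
    using assms by (simp_all add: t_def)
  have lhs: "d * (lambda - a) = t * (b + t\<^sup>2)"
    using t(1) by (simp add: b_def)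
  have rhs: "t^3 + 2 * sqrt d * t\<^sup>2 = t * (2 * sqrt d * t + t\<^sup>2)"
    by (simp add: algebra_simps power2_eq_square power3_eq_cube)
  show "d * (lambda - a) > (a + lambda)^3 + 2 * sqrt d * (a + lambda)\<^sup>2 \<longleftrightarrow>
      d * ((lambda - a) / (lambda + a)) - (lambda + a)\<^sup>2 > 2 * sqrt d * (lambda + a)"
    and "d * (lambda - a) < (a + lambda)^3 + 2 * sqrt d * (a + lambda)\<^sup>2 \<longleftrightarrow>
      d * ((lambda - a) / (lambda + a)) - (lambda + a)\<^sup>2 < 2 * sqrt d * (lambda + a)"
    unfolding t(2) t_def[symmetric] b_def[symmetric] lhs rhs
      mult_less_cancel_left_pos[OF t(1)] by simp_all
qed

text \<open>Completing the square: for \<open>\<nu> > 0\<close> the product exceeds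
  \<open>(sqrt d * \<nu> - R\<^sup>2 * (lambda + a))\<^sup>2\<close>. The linear coefficient may be
  very negative, so a discriminant argument alone would not do.\<close>

lemma root_prod_pos:
  assumes "R > 0" "d > 0" "lambda + a > 0" "\<nu> \<ge> 0"
    and "d * ((lambda - a) / (lambda + a)) - (lambda + a)\<^sup>2 < 2 * sqrt d * (lambda + a)"
  shows "root_prod R d a lambda \<nu> > 0"
\<comment> \<open>Strictness comes from multiplying by \<open>\<nu>\<close>, hence the separate
  case.\<close>
proof (cases "\<nu> = 0")
  case True
  then show ?thesis using root_prod_0_pos assms by simp
next
  case False
  define b where "b = d * ((lambda - a) / (lambda + a)) - (lambda + a)\<^sup>2"
  have "R\<^sup>2 * b * \<nu> < R\<^sup>2 * (2 * sqrt d * (lambda + a)) * \<nu>"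
    using False assms unfolding b_def by (intro mult_strict_right_mono mult_strict_left_mono) auto
  moreover have "(sqrt d * \<nu> - R\<^sup>2 * (lambda + a))\<^sup>2 =
      d * \<nu>\<^sup>2 - R\<^sup>2 * (2 * sqrt d * (lambda + a)) * \<nu> + R^4 * (lambda + a)\<^sup>2"
    using assms(2) by (simp add: power2_diff power_mult_distrib)
  ultimately show ?thesis
    unfolding root_prod_eq[OF assms(3)] b_def[symmetric]
    using zero_le_power2[of "sqrt d * \<nu> - R\<^sup>2 * (lambda + a)"] by linarith
qed

section \<open>Application to the Neumann modes\<close>

lemma neumann_spectrum_nonneg:
  assumes "neumann_spectrum \<delta> \<mu> B"
  shows "\<mu> k \<ge> 0"
proof -
  note spec = assms[unfolded neumann_spectrum_def]
  have 0: "\<mu> 0 = 0"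
    by (rule conjunct1[OF spec])
  have 1: "0 < \<mu> 1"
    by (rule conjunct1[OF conjunct2[OF spec]])
  have mono: "\<mu> k \<le> \<mu> (Suc k)" if "k \<ge> 1" for k
    using conjunct1[OF conjunct2[OF conjunct2[OF spec]]] that by blast
  \<comment> \<open>Monotonicity is given from index 1 on, so the induction starts at
    \<open>\<mu> 1\<close>.\<close>
  have "\<mu> (Suc n) > 0" for n
  proof (induction n)
    case 0
    then show ?case using 1 by simp
  next
    case (Suc n)
    then show ?case using mono[of "Suc n"] by simp
  qed
  then show ?thesis
    using 0 by (cases k) (auto simp: less_imp_le)
qed

theorem theorem3p2:
  fixes R d a lambda \<delta> :: real
    and \<mu> :: "nat \<Rightarrow> real"
    and B :: "nat \<Rightarrow> real^2 \<Rightarrow> real"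
    and u v :: "nat \<Rightarrow> nat \<Rightarrow> complex"
    and e :: "nat \<Rightarrow> nat \<Rightarrow> (real^2 \<Rightarrow> complex) \<times> (real^2 \<Rightarrow> complex)"
  assumes "R > 0" "d > 0" "a > 0" "lambda > 0" "\<delta> > 1"
    and "neumann_spectrum \<delta> \<mu> B"
    and "\<And>k l. l \<in> {1, 2} \<Longrightarrow>
           e k l = (\<lambda>x. u k l * of_real (B k x), \<lambda>x. v k l * of_real (B k x))"
    and "\<And>k l. l \<in> {1, 2} \<Longrightarrow>
           system_eigenvector R d a lambda \<delta> (beta R d a lambda (\<mu> k) l) (e k l)"
  shows
    "(lambda - a > (lambda + a)^3 \<longrightarrow> (\<forall>l\<in>{1, 2}. unstable R d a lambda \<delta> (e 0 l)))
     \<and>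
     (lambda - a < (lambda + a)^3 \<and>
      d * (lambda - a) > (a + lambda)^3 + 2 * sqrt d * (a + lambda)\<^sup>2 \<and>
      (\<forall>k. \<mu> k \<noteq> mu_minus R d a lambda \<and> \<mu> k \<noteq> mu_plus R d a lambda) \<longrightarrow>
        (\<forall>k. \<mu> k \<in> {mu_minus R d a lambda <..< mu_plus R d a lambda} \<longrightarrow>
           unstable R d a lambda \<delta> (e k 2)) \<and>
        (\<forall>k. \<forall>l\<in>{1, 2}.
           \<not> (l = 2 \<and> \<mu> k \<in> {mu_minus R d a lambda <..< mu_plus R d a lambda}) \<longrightarrow>
           stable R d a lambda \<delta> (e k l)) \<and>
        (\<forall>l\<in>{1, 2}. stable R d a lambda \<delta> (e 0 l)) \<and>
        ((\<forall>k. \<mu> k \<notin> {mu_minus R d a lambda <..< mu_plus R d a lambda}) \<longrightarrow>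
           (\<forall>k. \<forall>l\<in>{1, 2}. stable R d a lambda \<delta> (e k l))))
     \<and>
     (lambda - a < (lambda + a)^3 \<and>
      d * (lambda - a) < (a + lambda)^3 + 2 * sqrt d * (a + lambda)\<^sup>2 \<longrightarrow>
        (\<forall>k. \<forall>l\<in>{1, 2}. stable R d a lambda \<delta> (e k l)))"
proof -
  let ?I = "{mu_minus R d a lambda <..< mu_plus R d a lambda}"
  note pos = assms(1-5) and eig = assms(8)
  have t: "lambda + a > 0" using pos by simp
  have nonneg: "\<mu> k \<ge> 0" for k
    using assms(6) by (rule neumann_spectrum_nonneg)
  have mu0: "\<mu> 0 = 0"
    using assms(6) unfolding neumann_spectrum_def by blast
  \<comment> \<open>Since an eigenvector determines its eigenvalue, (in)stability of
    \<open>e k l\<close> is just the sign of the real part of \<open>beta\<close>.\<close>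
  have stable_e: "stable R d a lambda \<delta> (e k l)"
    if "Re (beta R d a lambda (\<mu> k) l) < 0" "l \<in> {1, 2}" for k l
    using stable_iff(1)[OF eig[OF that(2)]] that(1) by blast
  have unstable_e: "unstable R d a lambda \<delta> (e k l)"
    if "Re (beta R d a lambda (\<mu> k) l) > 0" "l \<in> {1, 2}" for k l
    using stable_iff(2)[OF eig[OF that(2)]] that(1) by blast

  have part1: "unstable R d a lambda \<delta> (e 0 l)"
    if "lambda - a > (lambda + a)^3" "l \<in> {1, 2}" for l
  proof (rule unstable_e)
    have "root_sum R d a lambda 0 > 0"
      using that pos t by (simp add: root_sum_0)
    then show "Re (beta R d a lambda (\<mu> 0) l) > 0"
      using Re_beta_pos root_prod_0_pos[OF \<open>R > 0\<close> t] mu0 by simp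
  qed (use that in simp)

  have part3: "stable R d a lambda \<delta> (e k l)"
    if "lambda - a < (lambda + a)^3"
      "d * (lambda - a) < (a + lambda)^3 + 2 * sqrt d * (a + lambda)\<^sup>2" "l \<in> {1, 2}" for k l
  proof (intro stable_e Re_beta_neg)
    show "root_sum R d a lambda (\<mu> k) < 0"
      using root_sum_neg[OF pos(1,2) t that(1) nonneg] .
    show "root_prod R d a lambda (\<mu> k) > 0"
      using root_prod_pos[OF pos(1,2) t nonneg] turing_condition_iff(2)[OF t] that(2) by blast
  qed (use that in simp)

  have part2: "\<mu> k \<in> ?I \<Longrightarrow> unstable R d a lambda \<delta> (e k 2)"
      "\<lbrakk>l \<in> {1, 2}; \<not> (l = 2 \<and> \<mu> k \<in> ?I)\<rbrakk> \<Longrightarrow> stable R d a lambda \<delta> (e k l)"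
      "\<mu> 0 \<notin> ?I"
    if sum: "lambda - a < (lambda + a)^3"
      and turing: "d * (lambda - a) > (a + lambda)^3 + 2 * sqrt d * (a + lambda)\<^sup>2"
      and nonres: "\<forall>k. \<mu> k \<noteq> mu_minus R d a lambda \<and> \<mu> k \<noteq> mu_plus R d a lambda" for k l
  proof -
    let ?b = "d * ((lambda - a) / (lambda + a)) - (lambda + a)\<^sup>2"
    have b: "?b > 2 * sqrt d * (lambda + a)"
      using turing turing_condition_iff(1)[OF t] by simp
    \<comment> \<open>Both sides are positive before squaring; the result is that the product has
      real zeros in \<open>\<nu>\<close>.\<close>
    have "(2 * sqrt d * (lambda + a))\<^sup>2 \<le> ?b\<^sup>2"
      using b t pos by (intro power_mono) auto
    then have disc: "?b\<^sup>2 \<ge> 4 * d * (lambda + a)\<^sup>2"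
      using pos by (simp add: power_mult_distrib)
    note fac = root_prod_factor[OF \<open>d > 0\<close> t disc, of R]
    have "?b > 0"
      using b t pos by (smt (verit) mult_pos_pos real_sqrt_gt_zero)
    then show "\<mu> 0 \<notin> ?I"
      using mu_minus_pos[OF \<open>R > 0\<close> \<open>d > 0\<close> t] mu0 by simp
    have inside: "root_prod R d a lambda (\<mu> k) < 0" if "\<mu> k \<in> ?I"
      using that pos unfolding fac by (simp add: mult_less_0_iff)
    show "unstable R d a lambda \<delta> (e k 2)" if "\<mu> k \<in> ?I"
      using inside[OF that] by (intro unstable_e Re_beta_saddle) auto
    have outside: "root_prod R d a lambda (\<mu> k) > 0" if "\<mu> k \<notin> ?I"
    proof -
      \<comment> \<open>Nonresonance excludes the endpoints, where the product vanishes and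
        \<open>beta\<close> with \<open>l = 2\<close> would be 0, neither stable nor
        unstable.\<close>
      have "\<mu> k < mu_minus R d a lambda \<or> \<mu> k > mu_plus R d a lambda"
        using that nonres[rule_format, of k] by force
      then show ?thesis
        using mu_minus_le_mu_plus[OF \<open>d > 0\<close> disc, of R] \<open>d > 0\<close>
        unfolding fac by (auto simp: zero_less_mult_iff mult_less_0_iff)
    qed
    show "stable R d a lambda \<delta> (e k l)" if "l \<in> {1, 2}" "\<not> (l = 2 \<and> \<mu> k \<in> ?I)"
    proof (cases "\<mu> k \<in> ?I")
      \<comment> \<open>Here \<open>l = 1\<close>, the negative root of the saddle pair.\<close>
      case True
      then show ?thesis
        using that by (intro stable_e Re_beta_saddle(2) inside) simp_all
    next
      case False
      then show ?thesis
        using that(1) root_sum_neg[OF pos(1,2) t sum nonneg] outside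
        by (intro stable_e Re_beta_neg) simp_all
    qed
  qed

  show ?thesis
  proof (intro conjI impI)
    show "\<forall>l\<in>{1, 2}. unstable R d a lambda \<delta> (e 0 l)" if "lambda - a > (lambda + a)^3"
      using part1[OF that] by blast
  next
    assume "lambda - a < (lambda + a)^3 \<and>
      d * (lambda - a) > (a + lambda)^3 + 2 * sqrt d * (a + lambda)\<^sup>2 \<and>
      (\<forall>k. \<mu> k \<noteq> mu_minus R d a lambda \<and> \<mu> k \<noteq> mu_plus R d a lambda)"
    then have c: "lambda - a < (lambda + a)^3"
      "d * (lambda - a) > (a + lambda)^3 + 2 * sqrt d * (a + lambda)\<^sup>2"
      "\<forall>k. \<mu> k \<noteq> mu_minus R d a lambda \<and> \<mu> k \<noteq> mu_plus R d a lambda"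
      by blast+
    show "\<forall>k. \<mu> k \<in> ?I \<longrightarrow> unstable R d a lambda \<delta> (e k 2)"
      using part2(1)[OF c] by blast
    show "\<forall>k. \<forall>l\<in>{1, 2}. \<not> (l = 2 \<and> \<mu> k \<in> ?I) \<longrightarrow> stable R d a lambda \<delta> (e k l)"
      using part2(2)[OF c] by blast
    show "\<forall>l\<in>{1, 2}. stable R d a lambda \<delta> (e 0 l)"
      using part2(2)[OF c] part2(3)[OF c] by blast
    show "\<forall>k. \<forall>l\<in>{1, 2}. stable R d a lambda \<delta> (e k l)" if "\<forall>k. \<mu> k \<notin> ?I"
      using part2(2)[OF c] that by blast
  next
    show "\<forall>k. \<forall>l\<in>{1, 2}. stable R d a lambda \<delta> (e k l)"
      if "lambda - a < (lambda + a)^3 \<and>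
        d * (lambda - a) < (a + lambda)^3 + 2 * sqrt d * (a + lambda)\<^sup>2"
      using part3 that by blast
  qed
qed

end
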